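(* For $|q|<1$, $$\sum_{n\ge 0}\frac{a^nq^{n(n+1)/2}(-1;q)_n}{(aq;q^2)_n(q;q)_n}=\frac{(-aq;q)_\infty}{(aq;q)_\infty}\sum_{r\ge 0}\frac{(-1)^ra^{3r}q^{5r^2}(-1;q)_{2r}(1-aq^{4r})(a;q^2)_r}{(1-a)(q^2;q^2)_r(-aq;q)_{2r}}.$$
   Context: $(x;q)_m=\prod_{j=0}^{m-1}(1-xq^j)$ and $(x;q)_\infty=\prod_{j=0}^\infty(1-xq^j)$. Here $a$ is a parameter for which no denominators vanish (equivalently, the identity holds as power series in $a$ and $q$). *)

theory Defs
  imports "HOL-Analysis.Analysis"
begin

definition qpoch :: "complex \<Rightarrow> complex \<Rightarrow> nat \<Rightarrow> complex" where
  "qpoch x q m = (\<Prod>j<m. 1 - x * q ^ j)"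

(* The library's prodinf allows vanishing factors (the product is then 0), so for
   norm q < 1 this is the limit of the partial products for every x. *)
definition qpoch_inf :: "complex \<Rightarrow> complex \<Rightarrow> complex" where
  "qpoch_inf x q = (\<Prod>j. 1 - x * q ^ j)"

end

theory Submission
  imports Defs
begin

text \<open>
  The identity is an instance of Bailey's lemma. Write $(x)_m$ for $(x;q)_m$ and
  $w_n = a^n q^{n(n+1)/2} (-1)_n$, so that the left-hand side is
  $\sum_n w_n \beta_n$ with $\beta_n = 1/((aq;q^2)_n (q)_n)$. Two facts are combined.

  The sequence $\beta_n$ belongs to a Bailey pair relative to $a$ that is supported on even
  indices (lemma \<open>bailey_pair\<close>):
  $\beta_n = \sum_{2r \le n} \alpha_{2r} / ((q)_{n-2r} (aq)_{n+2r})$. This is a terminating very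
  well-poised sum in base $q^2$; it is proved by creative telescoping in $n$, the
  rational certificate being \<open>bailey_certificate\<close>.

  The weights $w_n$ turn each Bailey kernel into a product (lemma \<open>bailey_weight_sum\<close>):
  $\sum_{n \ge N} w_n / ((q)_{n-N} (aq)_{n+N})
     = \frac{(-aq)_\infty}{(aq)_\infty} \frac{w_N}{(-aq)_N}$.
  After shifting $n$ this is the summation
  $\sum_m \frac{(A)_m (-z)^m q^{m(m-1)/2}}{(q)_m (Az)_m} = \frac{(z)_\infty}{(Az)_\infty}$
  (lemma \<open>phi11_sum\<close>), which follows by iterating a functional equation relating
  $z$ to $zq$.

  Substituting the Bailey pair in $\sum_n w_n \beta_n$ and exchanging the order of
  summation gives the right-hand side, since $\alpha_{2r} w_{2r} / (-aq)_{2r}$ is its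
  $r$-th summand. The exchange is legitimate because, with $n = m + 2r$, the double
  series is dominated by a product of two convergent series with Gaussian decay
  (lemma \<open>double_summand_bound\<close>).
\<close>

section \<open>Finite and infinite q-Pochhammer symbols\<close>

lemma qpoch_0 [simp]: "qpoch x q 0 = 1"
  by (simp add: qpoch_def)

lemma qpoch_Suc: "qpoch x q (Suc m) = qpoch x q m * (1 - x * q ^ m)"
  by (simp add: qpoch_def)

lemma qpoch_add: "qpoch x q (r + m) = qpoch x q r * qpoch (x * q ^ r) q m"
  by (induction m) (simp_all add: qpoch_Suc power_add mult.assoc)

lemma convergent_prod_qpoch:
  fixes x q :: complex
  assumes "norm q < 1"
  shows "convergent_prod (\<lambda>j. 1 - x * q ^ j)"
proof -
  have "summable (\<lambda>j. norm x * norm q ^ j)"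
    using assms by (intro summable_mult summable_geometric) simp
  moreover have "norm ((1 - x * q ^ j) - 1) = norm x * norm q ^ j" for j
    by (simp add: norm_mult norm_power)
  ultimately have "summable (\<lambda>j. norm ((1 - x * q ^ j) - 1))" by simp
  thus ?thesis
    by (intro abs_convergent_prod_imp_convergent_prod summable_imp_abs_convergent_prod)
qed

lemma qpoch_LIMSEQ:
  assumes "norm q < 1"
  shows "qpoch x q \<longlonglongrightarrow> qpoch_inf x q"
proof -
  have "(\<lambda>n. qpoch x q (Suc n)) \<longlonglongrightarrow> qpoch_inf x q"
    using convergent_prod_LIMSEQ[OF convergent_prod_qpoch[OF assms, of x]]
    by (simp add: qpoch_def qpoch_inf_def lessThan_Suc_atMost)
  thus ?thesis by (rule LIMSEQ_imp_Suc)
qed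

lemma qpoch_inf_split:
  assumes "norm q < 1"
  shows "qpoch_inf x q = qpoch x q r * qpoch_inf (x * q ^ r) q"
proof -
  have "(\<lambda>m. qpoch x q (m + r)) \<longlonglongrightarrow> qpoch_inf x q"
    by (intro LIMSEQ_ignore_initial_segment qpoch_LIMSEQ assms)
  moreover have "(\<lambda>m. qpoch x q (m + r)) \<longlonglongrightarrow> qpoch x q r * qpoch_inf (x * q ^ r) q"
    unfolding add.commute[of _ r] qpoch_add
    by (intro tendsto_intros qpoch_LIMSEQ assms)
  ultimately show ?thesis by (rule LIMSEQ_unique)
qed

lemma qpoch_nonzero:
  assumes "norm q < 1" "qpoch_inf x q \<noteq> 0"
  shows "qpoch x q m \<noteq> 0"
  using qpoch_inf_split[OF assms(1), of x m] assms(2) by auto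

lemma qpoch_inf_nonzero:
  assumes "norm q < 1" "\<And>m. qpoch x q m \<noteq> 0"
  shows "qpoch_inf x q \<noteq> 0"
  unfolding qpoch_inf_def
proof (rule prodinf_nonzero[OF convergent_prod_qpoch[OF assms(1)]])
  fix i show "1 - x * q ^ i \<noteq> 0"
    using assms(2)[of "Suc i"] by (simp add: qpoch_Suc)
qed

lemma qpoch_self_nonzero:
  assumes "norm q < 1"
  shows "qpoch q q m \<noteq> 0"
proof (induction m)
  case (Suc m)
  have "norm (q * q ^ m) < 1"
    using power_Suc_less_one[of "norm q" m] assms
    by (cases "q = 0") (auto simp: norm_mult norm_power)
  hence "1 - q * q ^ m \<noteq> 0" by auto
  with Suc show ?case by (simp add: qpoch_Suc)
qed simp

lemma qpoch_bounded:
  assumes "norm q < 1"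
  shows "\<exists>K>0. \<forall>m. norm (qpoch x q m) \<le> K"
  using convergent_imp_Bseq[OF convergentI[OF qpoch_LIMSEQ[OF assms, of x]]]
  by (simp only: Bseq_def)

text \<open>
  Nonzero partial products with a nonzero limit stay away from zero. This
  controls the denominators in the domination arguments.
\<close>
lemma qpoch_inverse_bounded:
  assumes "norm q < 1" "qpoch_inf x q \<noteq> 0"
  shows "\<exists>K>0. \<forall>m. norm (inverse (qpoch x q m)) \<le> K"
proof -
  have lim: "(\<lambda>m. inverse (qpoch x q m)) \<longlonglongrightarrow> inverse (qpoch_inf x q)"
    by (intro tendsto_inverse qpoch_LIMSEQ assms)
  show ?thesis
    using convergent_imp_Bseq[OF convergentI[OF lim]] by (simp only: Bseq_def)
qed

lemma summable_gaussian:
  fixes c Q :: real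
  assumes "0 \<le> c" "0 \<le> Q" "Q < 1"
  shows "summable (\<lambda>m. c ^ m * Q ^ (m * (m - 1) div 2))"
proof -
  have tri: "Suc m * (Suc m - 1) div 2 = m * (m - 1) div 2 + m" for m :: nat
  proof -
    have "Suc m * (Suc m - 1) = m * (m - 1) + 2 * m" by (cases m) auto
    thus ?thesis by simp
  qed
  have "(\<lambda>m. c * Q ^ m) \<longlonglongrightarrow> c * 0"
    using assms by (intro tendsto_intros LIMSEQ_power_zero) auto
  hence "eventually (\<lambda>m. c * Q ^ m < 1 / 2) sequentially"
    by (rule order_tendstoD) auto
  then obtain N where N: "\<And>m. m \<ge> N \<Longrightarrow> c * Q ^ m < 1 / 2"
    by (auto simp: eventually_sequentially)
  show ?thesis
  proof (rule summable_ratio_test[of "1/2" N])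
    fix m assume "m \<ge> N"
    have "c ^ Suc m * Q ^ (Suc m * (Suc m - 1) div 2)
        = (c * Q ^ m) * (c ^ m * Q ^ (m * (m - 1) div 2))"
      unfolding tri by (simp add: power_add)
    also have "\<dots> \<le> 1 / 2 * (c ^ m * Q ^ (m * (m - 1) div 2))"
      using N[OF \<open>m \<ge> N\<close>] assms by (intro mult_right_mono) auto
    finally show "norm (c ^ Suc m * Q ^ (Suc m * (Suc m - 1) div 2))
        \<le> 1 / 2 * norm (c ^ m * Q ^ (m * (m - 1) div 2))"
      using assms by (simp add: abs_mult power_abs)
  qed simp
qed

section \<open>A summation for the confluent series with one numerator parameter\<close>

text \<open>
  Summand of the basic hypergeometric series ${}_1\phi_1(A; Az; q, z)$, the
  limiting case of Heine's q-Gauss sum.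
\<close>
definition phi11_term :: "complex \<Rightarrow> complex \<Rightarrow> complex \<Rightarrow> nat \<Rightarrow> complex" where
  "phi11_term A z q m = qpoch A q m * (- z) ^ m * q ^ (m * (m - 1) div 2)
     / (qpoch q q m * qpoch (A * z) q m)"

text \<open>
  The bound is uniform in the shift $N$, because
  $(Azq^N)_m = (Az)_{N+m} / (Az)_N$ stays away from zero uniformly in $N$ and $m$.
\<close>
lemma phi11_term_bound:
  assumes q: "norm q < 1" and C: "qpoch_inf (A * z) q \<noteq> 0"
  shows "\<exists>K. \<forall>N m. norm (phi11_term A (z * q ^ N) q m)
        \<le> K * (norm z ^ m * norm q ^ (m * (m - 1) div 2))"
proof -
  obtain K1 where K1: "0 < K1" "\<And>m. norm (qpoch A q m) \<le> K1"
    using qpoch_bounded[OF q] by blast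
  obtain K2 where K2: "0 < K2" "\<And>m. norm (inverse (qpoch q q m)) \<le> K2"
    using qpoch_inverse_bounded[OF q qpoch_inf_nonzero[OF q qpoch_self_nonzero[OF q]]] by blast
  obtain K3 where K3: "0 < K3" "\<And>m. norm (qpoch (A * z) q m) \<le> K3"
    using qpoch_bounded[OF q] by blast
  obtain K4 where K4: "0 < K4" "\<And>m. norm (inverse (qpoch (A * z) q m)) \<le> K4"
    using qpoch_inverse_bounded[OF q C] by blast
  note nz = qpoch_nonzero[OF q C]
  show ?thesis
  proof (intro exI allI)
    fix N m :: nat
    have split: "qpoch (A * z) q (N + m) = qpoch (A * z) q N * qpoch (A * (z * q ^ N)) q m"
      by (simp only: qpoch_add mult.assoc)
    have inv: "inverse (qpoch (A * (z * q ^ N)) q m)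
        = qpoch (A * z) q N * inverse (qpoch (A * z) q (N + m))"
      unfolding split inverse_mult_distrib mult.assoc [symmetric] using nz[of N] by simp
    have "phi11_term A (z * q ^ N) q m
        = (qpoch A q m * inverse (qpoch q q m) *
            (qpoch (A * z) q N * inverse (qpoch (A * z) q (N + m)))) *
          ((- (z * q ^ N)) ^ m * q ^ (m * (m - 1) div 2))"
      unfolding phi11_term_def divide_inverse inverse_mult_distrib inv by (simp only: mult_ac)
    also have "norm \<dots> = (norm (qpoch A q m) * norm (inverse (qpoch q q m)) *
            (norm (qpoch (A * z) q N) * norm (inverse (qpoch (A * z) q (N + m))))) *
          ((norm z * norm q ^ N) ^ m * norm q ^ (m * (m - 1) div 2))"
      by (simp only: norm_mult norm_power norm_minus_cancel)
    also have "\<dots> \<le> (K1 * K2 * (K3 * K4)) *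
          ((norm z * 1) ^ m * norm q ^ (m * (m - 1) div 2))"
      by (intro mult_mono power_mono power_le_one order.refl mult_nonneg_nonneg zero_le_power
          norm_ge_zero zero_le_one less_imp_le[OF q] K1(2) K2(2) K3(2) K4(2)
          less_imp_le[OF K1(1)] less_imp_le[OF K2(1)] less_imp_le[OF K3(1)] less_imp_le[OF K4(1)])
    finally show "norm (phi11_term A (z * q ^ N) q m)
        \<le> (K1 * K2 * (K3 * K4)) * (norm z ^ m * norm q ^ (m * (m - 1) div 2))"
      by simp
  qed
qed

lemma summable_phi11_term:
  assumes "norm q < 1" "qpoch_inf (A * z) q \<noteq> 0"
  shows "summable (\<lambda>m. norm (phi11_term A z q m))"
proof -
  obtain K where K: "\<And>N m. norm (phi11_term A (z * q ^ N) q m)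
        \<le> K * (norm z ^ m * norm q ^ (m * (m - 1) div 2))"
    using phi11_term_bound[OF assms] by blast
  have bound: "norm (norm (phi11_term A z q m)) \<le> K * (norm z ^ m * norm q ^ (m * (m - 1) div 2))" for m
    using K[where N = 0 and m = m] by (simp only: power_0 mult_1_right real_norm_def abs_norm_cancel)
  have "summable (\<lambda>m. K * (norm z ^ m * norm q ^ (m * (m - 1) div 2)))"
    using assms(1) by (intro summable_mult summable_gaussian norm_ge_zero)
  thus ?thesis
    by (rule summable_comparison_test') (rule bound)
qed

text \<open>
  The difference of the two sides telescopes termwise: it is the increment of
  $G_m = -(1-q^m)(1-Az)\,t_m$, where $t_m$ is the summand at $z$. Since $G_0 = 0$ and
  $G_m \to 0$, its sum vanishes.
\<close>
lemma phi11_shift: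
  assumes q: "norm q < 1" and C: "qpoch_inf (A * z) q \<noteq> 0"
  shows "(1 - A * z) * (\<Sum>m. phi11_term A z q m) = (1 - z) * (\<Sum>m. phi11_term A (z * q) q m)"
proof -
  note nz = qpoch_nonzero[OF q C]
  have f: "1 - A * z * q ^ m \<noteq> 0" for m
    using nz[of "Suc m"] by (simp add: qpoch_Suc)
  have fq: "1 - q * q ^ m \<noteq> 0" for m
    using qpoch_self_nonzero[OF q, of "Suc m"] by (simp add: qpoch_Suc)
  have Cq: "qpoch_inf (A * (z * q)) q \<noteq> 0"
    using qpoch_inf_split[OF q, of "A * z" 1] C by (auto simp: mult.assoc)
  define G where "G = (\<lambda>m. - (1 - q ^ m) * ((1 - A * z) * phi11_term A z q m))"
  have shift: "phi11_term A (z * q) q m * (1 - A * z * q ^ m) = phi11_term A z q m * q ^ m * (1 - A * z)" for m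
  proof -
    have "qpoch (A * z) q m * (1 - A * z * q ^ m) = (1 - A * z) * qpoch (A * (z * q)) q m"
      using qpoch_add[of "A * z" q 1 m] qpoch_Suc[of "A * z" q m] qpoch_Suc[of "A * z" q 0]
      by (simp add: mult.assoc)
    thus ?thesis 
      using nz[of m] qpoch_nonzero[OF q Cq, of m] qpoch_self_nonzero[OF q, of m]
      unfolding phi11_term_def by (simp add: frac_eq_eq power_mult_distrib power_minus') (simp add: mult_ac)
  qed
  have Suc: "phi11_term A z q (Suc m) * ((1 - q * q ^ m) * (1 - A * z * q ^ m))
       = phi11_term A z q m * (1 - A * q ^ m) * (- z) * q ^ m" for m
  proof -
    have "Suc m * (Suc m - 1) = m * (m - 1) + 2 * m" by (cases m) auto
    hence tri: "Suc m * (Suc m - 1) div 2 = m * (m - 1) div 2 + m" by simp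
    have cancel: "(B * b) * (- z * Z) * (T * y) / ((P * g) * (C * h)) * (g * h)
        = B * Z * T / (P * C) * b * (- z) * y"
      if "P \<noteq> 0" "C \<noteq> 0" "g \<noteq> 0" "h \<noteq> 0" for B b Z T y P g C h :: complex
      using that by (simp add: field_simps)
    show ?thesis
      unfolding phi11_term_def tri qpoch_Suc power_add power_Suc
      by (rule cancel) (use nz qpoch_self_nonzero[OF q] f fq in auto)
  qed
  have tel: "(1 - A * z) * phi11_term A z q m - (1 - z) * phi11_term A (z * q) q m = G (Suc m) - G m" for m
  proof -
    define t where "t = phi11_term A z q m"
    define y where "y = q ^ m"
    have 1: "phi11_term A (z * q) q m = t * y * (1 - A * z) / (1 - A * z * y)"
      using shift[of m] f[of m] by (simp add: t_def y_def field_simps)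
    have 2: "(1 - q * y) * phi11_term A z q (Suc m) = t * (1 - A * y) * (- z) * y / (1 - A * z * y)"
      using Suc[of m] f[of m] by (simp add: t_def y_def field_simps)
    have "G (Suc m) - G m = - (1 - A * z) * ((1 - q * y) * phi11_term A z q (Suc m))
        + (1 - y) * ((1 - A * z) * t)"
      unfolding G_def y_def t_def power_Suc by algebra
    moreover have "(1 - A * z) * t - (1 - z) * (t * y * (1 - A * z) / (1 - A * z * y))
       = - (1 - A * z) * (t * (1 - A * y) * (- z) * y / (1 - A * z * y)) + (1 - y) * ((1 - A * z) * t)"
      using f[of m] unfolding y_def[symmetric] by (simp add: divide_simps) algebra
    ultimately show ?thesis unfolding 1 2 t_def [symmetric] by simp
  qed
  have s1: "summable (phi11_term A z q)" and s2: "summable (phi11_term A (z * q) q)"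
    using summable_phi11_term[OF q C] summable_phi11_term[OF q Cq] by (auto intro: summable_norm_cancel)
  have "G \<longlonglongrightarrow> - (1 - 0) * ((1 - A * z) * 0)"
    unfolding G_def using q s1 by (intro tendsto_intros LIMSEQ_power_zero summable_LIMSEQ_zero)
  hence "(\<lambda>m. G (Suc m) - G m) sums (0 - G 0)"
    by (intro telescope_sums) simp
  hence "(\<lambda>m. (1 - A * z) * phi11_term A z q m - (1 - z) * phi11_term A (z * q) q m) sums 0"
    unfolding tel by (simp add: G_def)
  moreover have "(\<lambda>m. (1 - A * z) * phi11_term A z q m - (1 - z) * phi11_term A (z * q) q m) sums
     ((1 - A * z) * (\<Sum>m. phi11_term A z q m) - (1 - z) * (\<Sum>m. phi11_term A (z * q) q m))"
    by (intro sums_diff sums_mult summable_sums s1 s2)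
  ultimately have "0 = (1 - A * z) * (\<Sum>m. phi11_term A z q m) - (1 - z) * (\<Sum>m. phi11_term A (z * q) q m)"
    by (rule sums_unique2)
  thus ?thesis by (simp only: right_minus_eq eq_commute[of 0])
qed

lemma phi11_shift_iterate:
  assumes q: "norm q < 1" and C: "qpoch_inf (A * z) q \<noteq> 0"
  shows "qpoch (A * z) q N * (\<Sum>m. phi11_term A z q m)
       = qpoch z q N * (\<Sum>m. phi11_term A (z * q ^ N) q m)"
proof (induction N)
  case (Suc N)
  have "qpoch_inf (A * (z * q ^ N)) q \<noteq> 0"
    using qpoch_inf_split[OF q, of "A * z" N] C by (auto simp: mult.assoc)
  from phi11_shift[OF q this]
  have step: "(1 - A * z * q ^ N) * (\<Sum>m. phi11_term A (z * q ^ N) q m)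
      = (1 - z * q ^ N) * (\<Sum>m. phi11_term A (z * q ^ Suc N) q m)"
    by (simp only: mult.assoc power_Suc2)
  have "qpoch (A * z) q (Suc N) * (\<Sum>m. phi11_term A z q m)
      = (1 - A * z * q ^ N) * (qpoch (A * z) q N * (\<Sum>m. phi11_term A z q m))"
    by (simp only: qpoch_Suc mult_ac)
  also have "\<dots> = qpoch z q N * ((1 - A * z * q ^ N) * (\<Sum>m. phi11_term A (z * q ^ N) q m))"
    unfolding Suc.IH by (simp only: mult_ac)
  also have "\<dots> = qpoch z q (Suc N) * (\<Sum>m. phi11_term A (z * q ^ Suc N) q m)"
    unfolding step by (simp only: qpoch_Suc mult.assoc)
  finally show ?case .
qed simp

text \<open>
  Letting $N \to \infty$ in the iterated functional equation, the argument $zq^N$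
  tends to $0$ and only the summand with $m = 0$ survives.
\<close>
lemma phi11_sum:
  assumes q: "norm q < 1" and C: "qpoch_inf (A * z) q \<noteq> 0"
  shows "(\<Sum>m. phi11_term A z q m) = qpoch_inf z q / qpoch_inf (A * z) q"
proof -
  obtain K where K: "\<And>N m. norm (phi11_term A (z * q ^ N) q m)
        \<le> K * (norm z ^ m * norm q ^ (m * (m - 1) div 2))"
    using phi11_term_bound[OF q C] by blast
  have lim: "(\<lambda>N. phi11_term A (z * q ^ N) q m) \<longlonglongrightarrow> (if m = 0 then 1 else 0)" for m
  proof -
    have "(\<lambda>N. z * q ^ N) \<longlonglongrightarrow> z * 0"
      by (intro tendsto_intros LIMSEQ_power_zero q)
    hence "(\<lambda>N. phi11_term A (z * q ^ N) q m) \<longlonglongrightarrow> phi11_term A 0 q m"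
      unfolding phi11_term_def qpoch_def
      by (intro tendsto_intros) (use qpoch_self_nonzero[OF q, of m] in \<open>auto simp: qpoch_def\<close>)
    thus ?thesis by (cases m) (auto simp: phi11_term_def)
  qed
  have "(\<lambda>N. \<Sum>m. phi11_term A (z * q ^ N) q m) \<longlonglongrightarrow> (\<Sum>m. if m = 0 then 1 else 0)"
  proof -
    have "eventually (\<lambda>(m, N). norm (phi11_term A (z * q ^ N) q m)
        \<le> K * (norm z ^ m * norm q ^ (m * (m - 1) div 2))) (at_top \<times>\<^sub>F at_top)"
      using K by (intro always_eventually) auto
    moreover have "summable (\<lambda>m. K * (norm z ^ m * norm q ^ (m * (m - 1) div 2)))"
      using q by (intro summable_mult summable_gaussian) auto
    ultimately show ?thesis
      using tannerys_theorem[of "\<lambda>m N. phi11_term A (z * q ^ N) q m"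
          "\<lambda>m. if m = 0 then 1 else 0" at_top] lim by auto
  qed
  moreover have "(\<Sum>m::nat. if m = 0 then 1 else (0::complex)) = 1"
    using sums_unique[OF sums_single[of 0 "\<lambda>_. 1 :: complex"]] by simp
  ultimately have "(\<lambda>N. qpoch z q N * (\<Sum>m. phi11_term A (z * q ^ N) q m)) \<longlonglongrightarrow> qpoch_inf z q * 1"
    by (intro tendsto_mult qpoch_LIMSEQ q) simp
  hence "(\<lambda>N. qpoch (A * z) q N * (\<Sum>m. phi11_term A z q m)) \<longlonglongrightarrow> qpoch_inf z q"
    unfolding phi11_shift_iterate[OF q C] by simp
  moreover have "(\<lambda>N. qpoch (A * z) q N * (\<Sum>m. phi11_term A z q m))
      \<longlonglongrightarrow> qpoch_inf (A * z) q * (\<Sum>m. phi11_term A z q m)"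
    by (intro tendsto_mult tendsto_const qpoch_LIMSEQ q)
  ultimately have "qpoch_inf z q = qpoch_inf (A * z) q * (\<Sum>m. phi11_term A z q m)"
    by (rule LIMSEQ_unique)
  thus ?thesis using C by (simp add: field_simps)
qed

section \<open>A Bailey pair supported on even indices\<close>

text \<open>
  The reciprocal $1/(q;q)_{m-j}$ with its usual value $0$ for $j > m$. This convention
  makes the sums over $r$ terminate by themselves and lets the telescoping
  identity hold for all $r$, including the boundary.
\<close>
definition inv_qfact :: "complex \<Rightarrow> nat \<Rightarrow> nat \<Rightarrow> complex" where
  "inv_qfact q m j = (if j \<le> m then 1 / qpoch q q (m - j) else 0)"

lemma inv_qfact_Suc:
  assumes "norm q < 1" "j \<le> m"
  shows "inv_qfact q m (Suc j) = (1 - q ^ (m - j)) * inv_qfact q m j"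
proof (cases "j = m")
  case False
  then obtain k where k: "m = Suc (j + k)"
    using assms(2) less_imp_Suc_add[of j m] by auto
  show ?thesis
    using qpoch_self_nonzero[OF assms(1), of k] qpoch_self_nonzero[OF assms(1), of "Suc k"]
    unfolding k inv_qfact_def by (simp add: qpoch_Suc)
qed (simp add: inv_qfact_def)

lemma inv_qfact_Suc_Suc: "inv_qfact q (Suc m) (Suc j) = inv_qfact q m j"
  by (simp add: inv_qfact_def)

text \<open>
  The entry $\alpha_{2r}$ of the Bailey pair without its very-well-poised factor
  $1 - aq^{4r}$. Leaving that factor out makes the ratio of consecutive values a
  short product.
\<close>
definition bailey_coeff :: "complex \<Rightarrow> complex \<Rightarrow> nat \<Rightarrow> complex" where
  "bailey_coeff a q r = (- a) ^ r * q ^ (3 * r ^ 2 - r) * qpoch a (q ^ 2) r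
     / ((1 - a) * qpoch (q ^ 2) (q ^ 2) r)"

definition bailey_summand :: "complex \<Rightarrow> complex \<Rightarrow> nat \<Rightarrow> nat \<Rightarrow> complex" where
  "bailey_summand a q n r = bailey_coeff a q r * (1 - a * q ^ (4 * r)) * inv_qfact q n (2 * r)
     / qpoch (a * q) q (n + 2 * r)"

text \<open>
  The q-Zeilberger certificate for \<open>bailey_summand\<close>. The truncated exponent is harmless:
  for $2r > n + 1$ the factor \<open>inv_qfact\<close> is zero.
\<close>
definition bailey_certificate :: "complex \<Rightarrow> complex \<Rightarrow> nat \<Rightarrow> nat \<Rightarrow> complex" where
  "bailey_certificate a q n r = - bailey_coeff a q r * (1 - q ^ (2 * r)) * q ^ (Suc n - 2 * r)
     * (1 - a * q ^ (n + 2 * r)) * inv_qfact q (Suc n) (2 * r) / qpoch (a * q) q (n + 2 * r)"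

lemma bailey_coeff_Suc:
  assumes q: "norm q < 1"
  shows "bailey_coeff a q (Suc r) * (1 - q ^ (2 * Suc r))
       = - a * q ^ (6 * r + 2) * (1 - a * q ^ (2 * r)) * bailey_coeff a q r"
proof -
  have "norm (q ^ 2) < 1" using q by (simp add: norm_power power_less_one_iff)
  note nz = qpoch_self_nonzero[OF this, of "Suc r"]
  have "r \<le> 3 * r ^ 2" by (simp add: power2_eq_square)
  hence e: "3 * Suc r ^ 2 - Suc r = (3 * r ^ 2 - r) + (6 * r + 2)"
    by (simp add: power2_eq_square)
  have p: "q ^ (2 * Suc r) = q ^ 2 * (q ^ 2) ^ r" "q ^ (2 * r) = (q ^ 2) ^ r"
    by (simp_all add: power_mult power2_eq_square)
  have cancel: "- a * B * (E * F) * (P * g) / (k * (D * d)) * d = - a * F * g * (B * E * P / (k * D))"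
    if "d \<noteq> 0" for B E F P g k D d :: complex
    using that by simp
  have "1 - q ^ 2 * (q ^ 2) ^ r \<noteq> 0" using nz by (simp add: qpoch_Suc)
  thus ?thesis
    unfolding bailey_coeff_def e p qpoch_Suc power_Suc power_add [of q "3 * r ^ 2 - r"] by (rule cancel)
qed

text \<open>
  Clears the denominators of the telescoping relation once and for all; what is left
  to check is then a polynomial identity.
\<close>
lemma combine_fractions:
  fixes c w D y F s t Z V :: complex
  assumes "D \<noteq> 0" "y \<noteq> 0" and id: "F * s - s * t * y = Z + V * y"
  shows "F * (c * s * w / (D * y)) - c * s * (t * w) / D = c * Z * w / (D * y) + c * V * w / D"
proof -
  have "F * (c * s * w / (D * y)) - c * s * (t * w) / D = c * w * (F * s - s * t * y) / (D * y)"
    using assms(1,2) by (simp add: field_simps)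
  also have "\<dots> = c * Z * w / (D * y) + c * V * w / D"
    unfolding id using assms(1,2) by (simp add: field_simps)
  finally show ?thesis .
qed

text \<open>
  The multiplier of the summand at $n+1$ is $\beta_n / \beta_{n+1}$. With $x = q^{2r}$ and
  $p = q^{n-2r}$, so that $q^n = px$, everything becomes a polynomial identity
  in $a, q, x, p$, valid also for $q = 0$. The case $2r = n+1$, where $p$ would have a
  negative exponent, is treated separately.
\<close>
lemma bailey_telescope:
  assumes q: "norm q < 1" and nz: "\<And>m. qpoch (a * q) q m \<noteq> 0"
  shows "(1 - a * q ^ (2 * n + 1)) * (1 - q ^ (n + 1)) * bailey_summand a q (Suc n) r
           - bailey_summand a q n r = bailey_certificate a q n (Suc r) - bailey_certificate a q n r"
proof -
  define c where "c = bailey_coeff a q r"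
  define x where "x = q ^ (2 * r)"
  define D where "D = qpoch (a * q) q (n + 2 * r)"
  define w where "w = inv_qfact q (Suc n) (2 * r)"
  define y where "y = 1 - a * q ^ (n + 2 * r) * q"
  have f: "1 - a * q ^ (m + 1) \<noteq> 0" for m
    using nz[of "Suc m"] by (simp add: qpoch_Suc mult_ac)
  have D0: "D \<noteq> 0" and y0: "y \<noteq> 0"
    using nz f[of "n + 2 * r"] by (simp_all add: D_def y_def mult_ac)
  have DS: "qpoch (a * q) q (Suc (n + 2 * r)) = D * y"
    by (simp add: qpoch_Suc D_def y_def mult_ac)
  have x2: "q ^ (4 * r) = x ^ 2" "q ^ (6 * r + 2) = x ^ 3 * q ^ 2"
    unfolding x_def power_mult [symmetric] power_add [symmetric]
    by (rule arg_cong[of _ _ "(^) q"], simp)+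
  have UD: "bailey_summand a q (Suc n) r = c * (1 - a * x ^ 2) * w / (D * y)"
    unfolding bailey_summand_def x2 c_def w_def add_Suc DS ..
  have U: "bailey_summand a q n r = c * (1 - a * x ^ 2) * inv_qfact q n (2 * r) / D"
    unfolding bailey_summand_def x2 c_def D_def ..
  have V: "bailey_certificate a q n r
      = - c * (1 - x) * q ^ (Suc n - 2 * r) * (1 - a * q ^ (n + 2 * r)) * w / D"
    unfolding bailey_certificate_def c_def x_def w_def D_def ..
  have VS: "bailey_certificate a q n (Suc r)
      = a * (x ^ 3 * q ^ 2) * (1 - a * x) * c * q ^ (n - Suc (2 * r)) * inv_qfact q n (Suc (2 * r)) / (D * y)"
  proof -
    have "qpoch (a * q) q (n + 2 * Suc r) = D * y * (1 - a * q ^ (n + 2 * Suc r))"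
      using DS qpoch_Suc[of "a * q" q "Suc (n + 2 * r)"] by (simp add: mult_ac)
    moreover have "1 - a * q ^ (n + 2 * Suc r) \<noteq> 0"
      using f[of "n + 2 * r + 1"] by simp
    moreover have "Suc n - 2 * Suc r = n - Suc (2 * r)" by simp
    moreover have "inv_qfact q (Suc n) (2 * Suc r) = inv_qfact q n (Suc (2 * r))"
      using inv_qfact_Suc_Suc[of q n "Suc (2 * r)"] by simp
    ultimately have "bailey_certificate a q n (Suc r) = - (bailey_coeff a q (Suc r) * (1 - q ^ (2 * Suc r)))
       * q ^ (n - Suc (2 * r)) * inv_qfact q n (Suc (2 * r)) / (D * y)"
      unfolding bailey_certificate_def by simp
    thus ?thesis unfolding bailey_coeff_Suc[OF q] x2 by (simp add: c_def x_def)
  qed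
  consider "2 * r \<le> n" | "2 * r = Suc n" | "2 * r > Suc n" by linarith
  thus ?thesis
  proof cases
    case 1
    define p where "p = q ^ (n - 2 * r)"
    have N: "q ^ n = p * x" using 1 by (simp add: p_def x_def power_add [symmetric])
    have pS: "q ^ (Suc n - 2 * r) = q * p" using 1 by (simp add: p_def Suc_diff_le)
    have J: "inv_qfact q n (2 * r) = (1 - q * p) * w"
      using inv_qfact_Suc[OF q, of "2 * r" "Suc n"] 1
      by (simp add: inv_qfact_Suc_Suc w_def p_def Suc_diff_le)
    have "q ^ (n - Suc (2 * r)) * inv_qfact q n (Suc (2 * r)) * q = p * (1 - p) * (1 - q * p) * w"
    proof (cases "n = 2 * r")
      case True
      thus ?thesis by (simp add: inv_qfact_def p_def)
    next
      case False
      hence "p = q ^ (n - Suc (2 * r)) * q"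
        using 1 unfolding p_def by (metis Suc_diff_Suc le_neq_implies_less power_Suc2)
      thus ?thesis
        using inv_qfact_Suc[OF q 1] J by (simp add: p_def mult_ac)
    qed
    hence VS': "bailey_certificate a q n (Suc r)
      = a * x ^ 3 * q * (1 - a * x) * c * (p * (1 - p) * (1 - q * p) * w) / (D * y)"
      unfolding VS by (simp add: power2_eq_square mult_ac)
    have e: "q ^ (2 * n + 1) = q * (p * x) ^ 2" "q ^ (n + 1) = q * (p * x)"
        "q ^ (n + 2 * r) = p * x * x"
      unfolding power_add N [symmetric] by (simp_all add: x_def power_mult [symmetric] mult.commute)
    have y: "y = 1 - a * q * (p * x) * x" unfolding y_def e by (simp add: mult_ac)
    show ?thesis
      unfolding UD U V VS' J pS e
    proof -
      let ?Z = "a * x ^ 3 * q * (1 - a * x) * (p * (1 - p) * (1 - q * p))"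
      let ?V = "(1 - x) * (q * p) * (1 - a * (p * x * x))"
      have "(1 - a * (q * (p * x) ^ 2)) * (1 - q * (p * x)) * (1 - a * x ^ 2)
          - (1 - a * x ^ 2) * (1 - q * p) * y = ?Z + ?V * y"
        unfolding y by algebra
      note id = combine_fractions[OF D0 y0 this, of c w]
      have "a * x ^ 3 * q * (1 - a * x) * c * (p * (1 - p) * (1 - q * p) * w) = c * ?Z * w"
        by (simp only: mult_ac)
      moreover have "- c * (1 - x) * (q * p) * (1 - a * (p * x * x)) * w = - (c * ?V * w)"
        by (simp only: mult_minus_left) (simp only: mult_ac)
      ultimately show "(1 - a * (q * (p * x) ^ 2)) * (1 - q * (p * x)) * (c * (1 - a * x ^ 2) * w / (D * y))
          - c * (1 - a * x ^ 2) * ((1 - q * p) * w) / D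
        = a * x ^ 3 * q * (1 - a * x) * c * (p * (1 - p) * (1 - q * p) * w) / (D * y)
          - - c * (1 - x) * (q * p) * (1 - a * (p * x * x)) * w / D"
        using id by (simp only: minus_divide_left [symmetric] diff_minus_eq_add)
    qed
  next
    case 2
    have "inv_qfact q n (2 * r) = 0" "inv_qfact q n (Suc (2 * r)) = 0" "q ^ (Suc n - 2 * r) = 1"
      using 2 by (simp_all add: inv_qfact_def)
    note z = this
    have e: "q ^ (n + 1) = x" using 2 by (simp add: x_def)
    have e2: "q ^ (2 * n + 1) = q ^ (n + 2 * r)" using 2 by (simp add: mult_2)
    have "q ^ (n + 2 * r) * q = q ^ (n + 1) * x"
      by (simp add: x_def power_add mult_ac)
    hence y: "1 - a * x ^ 2 = y"
      unfolding e y_def by (simp add: power2_eq_square mult.assoc)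
    have "u * v * (c * y * w / (D * y)) = c * v * u * w / D" for u v
      using D0 y0 by (simp add: field_simps)
    thus ?thesis
      unfolding UD U V VS z e e2 y by simp
  next
    case 3
    thus ?thesis
      unfolding UD U V VS by (simp add: w_def inv_qfact_def)
  qed
qed

lemma bailey_pair:
  assumes q: "norm q < 1" and a1: "a \<noteq> 1" and nz: "\<And>m. qpoch (a * q) q m \<noteq> 0"
    and nz2: "\<And>m. qpoch (a * q) (q ^ 2) m \<noteq> 0"
  shows "(\<Sum>r | 2 * r \<le> n. bailey_summand a q n r) = 1 / (qpoch (a * q) (q ^ 2) n * qpoch q q n)"
proof -
  have ext: "(\<Sum>r | 2 * r \<le> n. bailey_summand a q n r) = (\<Sum>r<M. bailey_summand a q n r)"
    if "n < M" for n M
    using that by (intro sum.mono_neutral_left) (auto simp: bailey_summand_def inv_qfact_def)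
  show ?thesis
  proof (induction n)
    case 0
    have "{r. 2 * r \<le> (0::nat)} = {0}" by auto
    thus ?case using a1 by (simp add: bailey_summand_def bailey_coeff_def inv_qfact_def)
  next
    case (Suc n)
    let ?f = "(1 - a * q ^ (2 * n + 1)) * (1 - q ^ (n + 1))"
    have "(\<Sum>r<n+2. ?f * bailey_summand a q (Suc n) r - bailey_summand a q n r)
        = bailey_certificate a q n (n + 2) - bailey_certificate a q n 0"
      unfolding bailey_telescope[OF q nz] by (rule sum_lessThan_telescope)
    also have "\<dots> = 0" by (simp add: bailey_certificate_def inv_qfact_def)
    finally have "?f * (\<Sum>r<n+2. bailey_summand a q (Suc n) r) = (\<Sum>r<n+2. bailey_summand a q n r)"
      by (simp only: sum_subtractf sum_distrib_left right_minus_eq)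
    hence "?f * (\<Sum>r | 2 * r \<le> Suc n. bailey_summand a q (Suc n) r)
        = 1 / (qpoch (a * q) (q ^ 2) n * qpoch q q n)"
      using Suc ext[of n "n+2"] ext[of "Suc n" "n+2"] by simp
    moreover have "qpoch (a * q) (q ^ 2) (Suc n) * qpoch q q (Suc n)
        = ?f * (qpoch (a * q) (q ^ 2) n * qpoch q q n)"
      by (simp add: qpoch_Suc power_mult [symmetric] mult_ac)
    moreover have "?f \<noteq> 0"
      using nz2[of "Suc n"] qpoch_self_nonzero[OF q, of "Suc n"]
      by (simp add: qpoch_Suc power_mult [symmetric] mult_ac)
    moreover have "S = 1 / Y" if "f * S = 1 / X" "Y = f * X" "f \<noteq> 0" for f S X Y :: complex
    proof -
      have "S = f * S / f" using that(3) by simp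
      also have "\<dots> = 1 / Y" unfolding that(1,2) by simp
      finally show ?thesis .
    qed
    ultimately show ?case by blast
  qed
qed

section \<open>Summing the weights against the Bailey kernel\<close>

definition bailey_weight :: "complex \<Rightarrow> complex \<Rightarrow> nat \<Rightarrow> complex" where
  "bailey_weight a q n = a ^ n * q ^ (n * (n + 1) div 2) * qpoch (- 1) q n"

text \<open>
  Splitting off the factors with $m = 0$ leaves the summand of ${}_1\phi_1$ with
  $A = -q^N$ and $z = -aq^{N+1}$, for which $Az = aq^{2N+1}$.
\<close>
lemma bailey_weight_sum:
  assumes q: "norm q < 1" and C: "qpoch_inf (a * q) q \<noteq> 0"
    and nz: "qpoch (- a * q) q N \<noteq> 0"
  shows "summable (\<lambda>m. norm (bailey_weight a q (m + N) / (qpoch q q m * qpoch (a * q) q (m + 2 * N))))"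
    and "(\<Sum>m. bailey_weight a q (m + N) / (qpoch q q m * qpoch (a * q) q (m + 2 * N)))
       = qpoch_inf (- a * q) q / qpoch_inf (a * q) q * (bailey_weight a q N / qpoch (- a * q) q N)"
proof -
  define A where "A = - (q ^ N)"
  define z where "z = - a * q * q ^ N"
  have Az: "A * z = a * q * q ^ (2 * N)"
    by (simp add: A_def z_def mult_2 power_add)
  have Cs: "qpoch_inf (a * q) q = qpoch (a * q) q (2 * N) * qpoch_inf (A * z) q"
    unfolding Az by (rule qpoch_inf_split[OF q])
  hence C': "qpoch_inf (A * z) q \<noteq> 0" using C by auto
  have Zs: "qpoch_inf (- a * q) q = qpoch (- a * q) q N * qpoch_inf z q"
    unfolding z_def by (rule qpoch_inf_split[OF q])
  define k where "k = bailey_weight a q N / qpoch (a * q) q (2 * N)"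
  have eq: "bailey_weight a q (m + N) / (qpoch q q m * qpoch (a * q) q (m + 2 * N))
      = k * phi11_term A z q m" for m
  proof -
    have "(m + N) * (m + N + 1) = N * (N + 1) + (m * (m - 1) + 2 * ((N + 1) * m))"
      by (cases m) (simp_all add: algebra_simps)
    moreover have "even (N * (N + 1))" "even (m * (m - 1))" by auto
    ultimately have tri: "(m + N) * (m + N + 1) div 2
        = N * (N + 1) div 2 + (m * (m - 1) div 2 + (N + 1) * m)"
      by presburger
    have "(- z) ^ m = a ^ m * q ^ ((N + 1) * m)"
      by (simp add: z_def power_mult_distrib power_mult power_add mult_ac)
    moreover have "qpoch (- 1) q (m + N) = qpoch (- 1) q N * qpoch A q m"
      using qpoch_add[of "- 1" q N m] by (simp add: A_def add.commute)
    moreover have "qpoch (a * q) q (m + 2 * N) = qpoch (a * q) q (2 * N) * qpoch (A * z) q m"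
      using qpoch_add[of "a * q" q "2 * N" m] by (simp add: Az add.commute)
    ultimately show ?thesis
      unfolding k_def bailey_weight_def phi11_term_def tri
      by (simp add: power_add mult_ac)
  qed
  show "summable (\<lambda>m. norm (bailey_weight a q (m + N) / (qpoch q q m * qpoch (a * q) q (m + 2 * N))))"
    unfolding eq norm_mult by (intro summable_mult summable_phi11_term q C')
  have "(\<Sum>m. k * phi11_term A z q m) = k * (qpoch_inf z q / qpoch_inf (A * z) q)"
    using suminf_mult[OF summable_norm_cancel[OF summable_phi11_term[OF q C']], of k]
    by (simp add: phi11_sum[OF q C'])
  thus "(\<Sum>m. bailey_weight a q (m + N) / (qpoch q q m * qpoch (a * q) q (m + 2 * N)))
       = qpoch_inf (- a * q) q / qpoch_inf (a * q) q * (bailey_weight a q N / qpoch (- a * q) q N)"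
    unfolding eq Cs Zs k_def using nz by simp
qed

section \<open>Exchanging the order of summation\<close>

text \<open>
  The double series is indexed by $r$ and $m = n - 2r$, so that it runs over all pairs
  of natural numbers.
\<close>
definition double_summand :: "complex \<Rightarrow> complex \<Rightarrow> nat \<Rightarrow> nat \<Rightarrow> complex" where
  "double_summand a q r m = bailey_coeff a q r * (1 - a * q ^ (4 * r)) *
     (bailey_weight a q (m + 2 * r) / (qpoch q q m * qpoch (a * q) q (m + 2 * (2 * r))))"

text \<open>
  The Pochhammer symbols in the numerator and the reciprocals of those in the
  denominator are bounded, so only the powers of $a$ and $q$ matter. The exponent $3r^2 - r + (m+2r)(m+2r+1)/2$ of $q$ is at least
  $r(r-1)/2 + m(m-1)/2$, which separates the variables.
\<close>
lemma double_summand_bound: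
  assumes q: "norm q < 1" and C: "qpoch_inf (a * q) q \<noteq> 0"
  shows "\<exists>K. \<forall>r m. norm (double_summand a q r m) \<le>
      K * ((norm a ^ 3) ^ r * norm q ^ (r * (r - 1) div 2)) * (norm a ^ m * norm q ^ (m * (m - 1) div 2))"
proof -
  have q2: "norm (q ^ 2) < 1" using q by (simp add: norm_power power_less_one_iff)
  obtain K1 where K1: "0 < K1" "\<And>m. norm (qpoch a (q ^ 2) m) \<le> K1"
    using qpoch_bounded[OF q2] by blast
  obtain K2 where K2: "0 < K2" "\<And>m. norm (inverse (qpoch (q ^ 2) (q ^ 2) m)) \<le> K2"
    using qpoch_inverse_bounded[OF q2 qpoch_inf_nonzero[OF q2 qpoch_self_nonzero[OF q2]]] by blast
  obtain K3 where K3: "0 < K3" "\<And>m. norm (qpoch (- 1) q m) \<le> K3"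
    using qpoch_bounded[OF q] by blast
  obtain K4 where K4: "0 < K4" "\<And>m. norm (inverse (qpoch q q m)) \<le> K4"
    using qpoch_inverse_bounded[OF q qpoch_inf_nonzero[OF q qpoch_self_nonzero[OF q]]] by blast
  obtain K5 where K5: "0 < K5" "\<And>m. norm (inverse (qpoch (a * q) q m)) \<le> K5"
    using qpoch_inverse_bounded[OF q C] by blast
  define k where "k = norm (inverse (1 - a))"
  have k: "0 \<le> k" by (simp add: k_def)
  show ?thesis
  proof (intro exI allI)
    fix r m :: nat
    define e where "e = 3 * r ^ 2 - r + (m + 2 * r) * (m + 2 * r + 1) div 2"
    have "norm (1 - a * q ^ (4 * r)) \<le> 1 + norm a * norm q ^ (4 * r)"
      by (metis norm_mult norm_one norm_power norm_triangle_ineq4)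
    also have "\<dots> \<le> 1 + norm a * 1"
      using q by (intro add_mono mult_left_mono power_le_one) auto
    finally have f: "norm (1 - a * q ^ (4 * r)) \<le> 1 + norm a" by simp
    have "r * (r - 1) div 2 \<le> 3 * r ^ 2 - r"
      by (cases r) (auto simp: power2_eq_square)
    moreover have "m * (m - 1) div 2 \<le> (m + 2 * r) * (m + 2 * r + 1) div 2"
      by (intro div_le_mono mult_le_mono) auto
    ultimately have e: "norm q ^ e \<le> norm q ^ (r * (r - 1) div 2) * norm q ^ (m * (m - 1) div 2)"
      unfolding power_add [symmetric] e_def using q by (intro power_decreasing add_mono) auto
    have "double_summand a q r m = (qpoch a (q ^ 2) r * inverse (qpoch (q ^ 2) (q ^ 2) r) *
        qpoch (- 1) q (m + 2 * r) * inverse (qpoch q q m) * inverse (qpoch (a * q) q (m + 2 * (2 * r))) *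
        inverse (1 - a) * (1 - a * q ^ (4 * r))) * ((- a) ^ r * a ^ (m + 2 * r) * q ^ e)"
      unfolding double_summand_def bailey_coeff_def bailey_weight_def e_def divide_inverse
        inverse_mult_distrib power_add [of q] by (simp only: mult_ac)
    also have "norm \<dots> = (norm (qpoch a (q ^ 2) r) * norm (inverse (qpoch (q ^ 2) (q ^ 2) r)) *
        norm (qpoch (- 1) q (m + 2 * r)) * norm (inverse (qpoch q q m)) *
        norm (inverse (qpoch (a * q) q (m + 2 * (2 * r)))) *
        k * norm (1 - a * q ^ (4 * r))) * (norm a ^ r * norm a ^ (m + 2 * r) * norm q ^ e)"
      by (simp only: norm_mult norm_power norm_minus_cancel k_def)
    also have "\<dots> \<le> (K1 * K2 * K3 * K4 * K5 * k * (1 + norm a)) * (norm a ^ r * norm a ^ (m + 2 * r) *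
        (norm q ^ (r * (r - 1) div 2) * norm q ^ (m * (m - 1) div 2)))"
      by (intro mult_mono order.refl mult_nonneg_nonneg add_nonneg_nonneg zero_le_power
          norm_ge_zero zero_le_one f e k K1(2) K2(2) K3(2) K4(2) K5(2)
          less_imp_le[OF K1(1)] less_imp_le[OF K2(1)] less_imp_le[OF K3(1)] less_imp_le[OF K4(1)]
          less_imp_le[OF K5(1)])
    also have "norm a ^ r * norm a ^ (m + 2 * r) = (norm a ^ 3) ^ r * norm a ^ m"
      unfolding power_mult [symmetric] power_add [symmetric] by (rule arg_cong[of _ _ "(^) (norm a)"]) simp
    finally show "norm (double_summand a q r m) \<le> (K1 * K2 * K3 * K4 * K5 * k * (1 + norm a)) *
       ((norm a ^ 3) ^ r * norm q ^ (r * (r - 1) div 2)) * (norm a ^ m * norm q ^ (m * (m - 1) div 2))"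
      by (simp add: mult_ac)
  qed
qed

lemma double_summand_summable:
  assumes q: "norm q < 1" and C: "qpoch_inf (a * q) q \<noteq> 0"
  shows "(\<lambda>(r, m). double_summand a q r m) summable_on UNIV \<times> UNIV"
proof -
  obtain K where K: "\<And>r m. norm (double_summand a q r m) \<le>
      K * ((norm a ^ 3) ^ r * norm q ^ (r * (r - 1) div 2)) * (norm a ^ m * norm q ^ (m * (m - 1) div 2))"
    using double_summand_bound[OF assms] by blast
  define v where "v = (\<lambda>r. (norm a ^ 3) ^ r * norm q ^ (r * (r - 1) div 2))"
  define u where "u = (\<lambda>m. norm a ^ m * norm q ^ (m * (m - 1) div 2))"
  have "summable v" "summable u"
    unfolding v_def u_def by (intro summable_gaussian zero_le_power norm_ge_zero q)+
  moreover have "0 \<le> v r" "0 \<le> u m" for r m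
    by (simp_all add: v_def u_def)
  ultimately have vu: "summable v" "summable u" "\<And>r. 0 \<le> v r" "\<And>m. 0 \<le> u m"
    by blast+
  have U: "(u has_sum suminf u) UNIV"
    using vu by (intro norm_summable_imp_has_sum summable_sums) auto
  have V: "v summable_on UNIV"
    using vu by (intro norm_summable_imp_summable_on) auto
  have "(\<lambda>(r, m). v r * u m) summable_on UNIV \<times> UNIV"
  proof (rule summable_on_SigmaI)
    show "((\<lambda>m. case (r, m) of (r, m) \<Rightarrow> v r * u m) has_sum v r * suminf u) UNIV" for r
      using has_sum_cmult_right[OF U, of "v r"] by simp
    show "(\<lambda>r. v r * suminf u) summable_on UNIV"
      by (rule summable_on_cmult_left[OF V])
  qed (use vu in auto)
  hence "(\<lambda>p. K * (case p of (r, m) \<Rightarrow> v r * u m)) summable_on UNIV \<times> UNIV"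
    by (rule summable_on_cmult_right)
  hence "(\<lambda>p. norm (case p of (r, m) \<Rightarrow> double_summand a q r m)) summable_on UNIV \<times> UNIV"
    by (rule Infinite_Sum.abs_summable_on_comparison_test') (use K in \<open>auto simp: u_def v_def mult_ac\<close>)
  thus ?thesis by (rule abs_summable_summable)
qed

theorem mainTheorem5:
  fixes a q :: complex
  assumes "norm q < 1"
    and "a \<noteq> 1"
    and "\<And>n. qpoch (a * q) (q ^ 2) n \<noteq> 0"
    and "qpoch_inf (a * q) q \<noteq> 0"
    and "\<And>r. qpoch (- a * q) q (2 * r) \<noteq> 0"
  defines "L \<equiv> \<lambda>n::nat. a ^ n * q ^ (n * (n + 1) div 2) * qpoch (- 1) q n
                 / (qpoch (a * q) (q ^ 2) n * qpoch q q n)"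
    and "R \<equiv> \<lambda>r::nat. (- 1) ^ r * a ^ (3 * r) * q ^ (5 * r ^ 2) * qpoch (- 1) q (2 * r)
                 * (1 - a * q ^ (4 * r)) * qpoch a (q ^ 2) r
                 / ((1 - a) * qpoch (q ^ 2) (q ^ 2) r * qpoch (- a * q) q (2 * r))"
  shows "summable L \<and> summable R \<and>
         (\<Sum>n. L n) = qpoch_inf (- a * q) q / qpoch_inf (a * q) q * (\<Sum>r. R r)"
proof -
  note q = assms(1) and C = assms(4)
  define c where "c = qpoch_inf (- a * q) q / qpoch_inf (a * q) q"
  have "qpoch (- a * q) q m \<noteq> 0" for m
    using assms(5)[of m] qpoch_add[of "- a * q" q m m] by (auto simp: mult_2)
  \<comment> \<open>Needed to recover the convergence of the series \<open>R\<close> from that of \<open>c * R r\<close>.\<close>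
  hence c0: "c \<noteq> 0"
    using qpoch_inf_nonzero[OF q] C by (simp add: c_def)
  define T where "T = infsum (\<lambda>(r, m). double_summand a q r m) (UNIV \<times> UNIV)"
  have T: "((\<lambda>(r, m). double_summand a q r m) has_sum T) (UNIV \<times> UNIV)"
    unfolding T_def by (rule has_sum_infsum[OF double_summand_summable[OF q C]])
  have "((\<lambda>r. c * R r) has_sum T) UNIV"
  proof (rule has_sum_SigmaD[OF T])
    fix r
    have "((\<lambda>m. double_summand a q r m) has_sum
       bailey_coeff a q r * (1 - a * q ^ (4 * r)) * (c * (bailey_weight a q (2 * r) / qpoch (- a * q) q (2 * r)))) UNIV"
      unfolding double_summand_def c_def bailey_weight_sum(2)[OF q C assms(5), symmetric]
      by (intro has_sum_cmult_right norm_summable_imp_has_sum bailey_weight_sum(1)[OF q C assms(5)]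
          summable_sums summable_norm_cancel[OF bailey_weight_sum(1)[OF q C assms(5)]])
    moreover have "bailey_coeff a q r * (1 - a * q ^ (4 * r)) *
        (c * (bailey_weight a q (2 * r) / qpoch (- a * q) q (2 * r))) = c * R r"
    proof -
      have "r \<le> 3 * r ^ 2" by (simp add: power2_eq_square)
      moreover have "2 * r * (2 * r + 1) div 2 = 2 * r ^ 2 + r"
        by (simp add: power2_eq_square)
      ultimately have "5 * r ^ 2 = 3 * r ^ 2 - r + 2 * r * (2 * r + 1) div 2" by linarith
      moreover have "(- 1) ^ r * a ^ (3 * r) = (- a) ^ r * a ^ (2 * r)"
        by (simp add: power_minus[of a] power_add [symmetric])
      ultimately show ?thesis
        unfolding R_def bailey_coeff_def bailey_weight_def by (simp only: power_add) (simp add: mult_ac)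
    qed
    ultimately show "((\<lambda>m. case (r, m) of (r, m) \<Rightarrow> double_summand a q r m) has_sum c * R r) UNIV"
      by simp
  qed
  hence R: "R sums (T / c)"
    using sums_divide[OF has_sum_imp_sums, of "\<lambda>r. c * R r" T c] c0 by simp
  have "((\<lambda>(n, r). double_summand a q r (n - 2 * r)) has_sum T) (SIGMA n:UNIV. {r. 2 * r \<le> n})"
    using T
    by (subst has_sum_reindex_bij_witness[where i = "\<lambda>(r, m). (m + 2 * r, r)"
          and j = "\<lambda>(n, r). (r, n - 2 * r)" and T = "UNIV \<times> UNIV"
          and h = "\<lambda>(r, m). double_summand a q r m" and s' = T]) auto
  hence "(L has_sum T) UNIV"
  proof (rule has_sum_SigmaD)
    fix n :: nat
    have fin: "finite {r. 2 * r \<le> n}"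
      by (rule finite_subset[of _ "{..n}"]) auto
    have "(\<Sum>r | 2 * r \<le> n. double_summand a q r (n - 2 * r))
        = (\<Sum>r | 2 * r \<le> n. bailey_weight a q n * bailey_summand a q n r)"
    proof (rule sum.cong)
      fix r assume "r \<in> {r. 2 * r \<le> n}"
      hence "n - 2 * r + 2 * r = n" "n - 2 * r + 2 * (2 * r) = n + 2 * r" "2 * r \<le> n" by auto
      thus "double_summand a q r (n - 2 * r) = bailey_weight a q n * bailey_summand a q n r"
        unfolding double_summand_def bailey_summand_def inv_qfact_def by (simp add: mult_ac add_ac)
    qed simp
    also have "\<dots> = L n"
      unfolding sum_distrib_left [symmetric]
        bailey_pair[OF q assms(2) qpoch_nonzero[OF q C] assms(3)]
      by (simp add: L_def bailey_weight_def)
    finally show "((\<lambda>r. case (n, r) of (n, r) \<Rightarrow> double_summand a q r (n - 2 * r)) has_sum L n) {r. 2 * r \<le> n}"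
      using has_sum_finite[OF fin, of "\<lambda>r. double_summand a q r (n - 2 * r)"] by simp
  qed
  hence L: "L sums T" by (rule has_sum_imp_sums)
  show ?thesis
    using L R c0 unfolding c_def[symmetric] by (auto simp: sums_iff)
qed

end
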